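(* There exists an absolute constant $c>0$ such that for all $n,d\in\mathbb{N}$ with $n\ge 2$ and $d\ge 2$, \[ \operatorname{disp}(n,d) \;\le\; c\,\log_2(n)\,\sqrt{\frac{\log_2(d)}{n}}. \]
   Context: For $d\in\mathbb{N}$ and a finite point set $\mathcal{P}\subset[0,1]^d$, the dispersion of $\mathcal{P}$ is \[ \operatorname{disp}(\mathcal{P}) := \sup_{B\colon B\cap\mathcal{P}=\varnothing} |B|, \] where the supremum is over all axis-parallel boxes $B=I_1\times\dots\times I_d$ with intervals $I_\ell\subset[0,1]$ such that $B\cap\mathcal{P}=\varnothing$, and $|B|$ denotes the Lebesgue volume of $B$. For $n,d\in\mathbb{N}$, the $n$th-minimal dispersion is \[ \operatorname{disp}(n,d) := \inf_{\substack{\mathcal{P}\subset[0,1]^d\colon\\ \#\mathcal{P}=n}} \operatorname{disp}(\mathcal{P}), \] where $\#\mathcal{P}$ denotes the cardinality of $\mathcal{P}$. *)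

theory Defs
  imports "HOL-Analysis.Analysis"
begin

text \<open>
  The dimension \<open>d\<close> is a natural number that varies inside the statement, so a point of \<open>\<real>\<^sup>d\<close> is an
  extensional function on the index set \<open>{..<d}\<close> (with value \<open>undefined\<close> outside), and the
  \<open>d\<close>-dimensional Lebesgue measure is the \<open>d\<close>-fold product of \<open>lborel\<close>.
\<close>

definition unit_cube :: "nat \<Rightarrow> (nat \<Rightarrow> real) set" where
  "unit_cube d = (\<Pi>\<^sub>E l\<in>{..<d}. {0..1})"

definition lebesgue_volume :: "nat \<Rightarrow> (nat \<Rightarrow> real) set \<Rightarrow> real" where
  "lebesgue_volume d B = measure (\<Pi>\<^sub>M l\<in>{..<d}. lborel) B"

text \<open>
  The factors may be open, closed, half-open or degenerate intervals.
\<close>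

definition axis_parallel_boxes :: "nat \<Rightarrow> (nat \<Rightarrow> real) set set" where
  "axis_parallel_boxes d =
     {\<Pi>\<^sub>E l\<in>{..<d}. I l | I. \<forall>l<d. is_interval (I l) \<and> I l \<subseteq> {0..1}}"

text \<open>
  For a finite point set and \<open>d \<ge> 1\<close> the supremum below is over a nonempty set of reals in \<open>[0,1]\<close>,
  and so is the infimum in the definition of \<open>min_dispersion\<close>; hence the conventions for \<open>Sup\<close> and
  \<open>Inf\<close> of empty or unbounded sets of reals play no role.
\<close>

definition dispersion :: "nat \<Rightarrow> (nat \<Rightarrow> real) set \<Rightarrow> real" where
  "dispersion d P =
     (SUP B \<in> {B \<in> axis_parallel_boxes d. B \<inter> P = {}}. lebesgue_volume d B)"

definition min_dispersion :: "nat \<Rightarrow> nat \<Rightarrow> real" where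
  "min_dispersion n d =
     (INF P \<in> {P. P \<subseteq> unit_cube d \<and> finite P \<and> card P = n}. dispersion d P)"

end

theory Submission
  imports Defs
begin

text \<open>
  Put the regular grid with \<open>m - 1\<close> interior points per axis, \<open>m \<approx> 2/\<epsilon>\<close>, into the cube. A box of
  volume above \<open>\<epsilon>\<close> contains at least the fraction \<open>\<epsilon>/2\<close> of the grid. A side longer
  than \<open>1 - 1/m\<close> catches every grid coordinate, and at most \<open>m ln (1/\<epsilon>)\<close> sides are shorter, so the
  large boxes leave at most \<open>(d m\<^sup>2) ^ (m ln (1/\<epsilon>))\<close> different traces on the grid. Choosing greedily
  the grid point that lies in the largest number of traces not yet hit multiplies their number by at
  most \<open>1 - \<epsilon>/2\<close>, so \<open>n\<close> points hit all of them once
  \<open>n > (2/\<epsilon>) m ln (1/\<epsilon>) ln (d m\<^sup>2)\<close>, which allows \<open>\<epsilon>\<close> of the order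
  \<open>log\<^sub>2 n \<cdot> sqrt (log\<^sub>2 d / n)\<close>.
\<close>

section \<open>Greedy hitting sets\<close>

text \<open>Double counting of the incidences \<open>x \<in> S\<close>: each set contributes at
  least \<open>p * card G\<close> of them, so the average number of sets through a point of
  \<open>G\<close> is at least \<open>p * card F\<close>, and some point reaches the
  average.\<close>

lemma exists_point_in_many_sets:
  fixes G :: "'a set" and F :: "'a set set" and p :: real
  assumes "finite G" "G \<noteq> {}" "finite F"
    and sub: "\<And>S. S \<in> F \<Longrightarrow> S \<subseteq> G"
    and dens: "\<And>S. S \<in> F \<Longrightarrow> p * real (card G) \<le> real (card S)"
  shows "\<exists>x\<in>G. p * real (card F) \<le> real (card {S \<in> F. x \<in> S})"
proof (rule ccontr)
  assume "\<not> ?thesis"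
  then have less: "real (card {S \<in> F. x \<in> S}) < p * real (card F)" if "x \<in> G" for x
    using that by force
  have "(\<Sum>S\<in>F. p * real (card G)) \<le> (\<Sum>S\<in>F. real (card {x \<in> G. x \<in> S}))"
  proof (rule sum_mono)
    fix S assume "S \<in> F"
    then have "{x \<in> G. x \<in> S} = S" using sub by auto
    then show "p * real (card G) \<le> real (card {x \<in> G. x \<in> S})" using dens[OF \<open>S \<in> F\<close>] by simp
  qed
  also have "\<dots> = (\<Sum>x\<in>G. real (card {S \<in> F. x \<in> S}))"
    using sum_multicount_gen[OF assms(1,3), of "\<lambda>x S. x \<in> S" "\<lambda>S. card {x \<in> G. x \<in> S}"]
    by (simp flip: of_nat_sum)
  also have "\<dots> < (\<Sum>x\<in>G. p * real (card F))"
    using less assms(1,2) by (intro sum_strict_mono) auto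
  finally show False by (simp add: mult_ac)
qed

text \<open>The averaging lemma applies again to the sets not yet hit, as they keep their density in
  the whole of \<open>G\<close>. Each new point thus removes at least the fraction \<open>p\<close>
  of them. The cardinality of \<open>T\<close> is only bounded by \<open>n\<close>, because once
  everything is hit a chosen point may repeat.\<close>

lemma greedy_hitting_set:
  fixes G :: "'a set" and F :: "'a set set" and p :: real
  assumes "finite G" "G \<noteq> {}" "finite F" "p \<le> 1"
    and sub: "\<And>S. S \<in> F \<Longrightarrow> S \<subseteq> G"
    and dens: "\<And>S. S \<in> F \<Longrightarrow> p * real (card G) \<le> real (card S)"
  shows "\<exists>T\<subseteq>G. card T \<le> n \<and> real (card {S \<in> F. S \<inter> T = {}}) \<le> (1 - p) ^ n * real (card F)"
proof (induction n)
  case 0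
  show ?case by (intro exI[of _ "{}"]) auto
next
  case (Suc n)
  then obtain T where T: "T \<subseteq> G" "card T \<le> n"
    "real (card {S \<in> F. S \<inter> T = {}}) \<le> (1 - p) ^ n * real (card F)" by blast
  let ?F = "{S \<in> F. S \<inter> T = {}}"
  obtain x where x: "x \<in> G" "p * real (card ?F) \<le> real (card {S \<in> ?F. x \<in> S})"
    using exists_point_in_many_sets[of G ?F p] assms by auto
  have "{S \<in> F. S \<inter> insert x T = {}} = ?F - {S \<in> ?F. x \<in> S}" by auto
  then have "card {S \<in> F. S \<inter> insert x T = {}} = card ?F - card {S \<in> ?F. x \<in> S}"
    using assms(3) by (simp only:) (intro card_Diff_subset, auto)
  moreover have "card {S \<in> ?F. x \<in> S} \<le> card ?F" using assms(3) by (intro card_mono) auto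
  ultimately have "real (card {S \<in> F. S \<inter> insert x T = {}}) = real (card ?F) - real (card {S \<in> ?F. x \<in> S})"
    by linarith
  also have "\<dots> \<le> (1 - p) * real (card ?F)" using x(2) by (simp add: algebra_simps)
  \<comment> \<open>Here \<open>p \<le> 1\<close> enters: the factor \<open>1 - p\<close> must be
    nonnegative.\<close>
  also have "\<dots> \<le> (1 - p) * ((1 - p) ^ n * real (card F))"
    using T(3) assms(4) by (intro mult_left_mono) auto
  finally have "real (card {S \<in> F. S \<inter> insert x T = {}}) \<le> (1 - p) ^ Suc n * real (card F)"
    by (simp add: mult_ac)
  moreover have "card (insert x T) \<le> Suc n"
    using T(2) by (metis Suc_le_mono card_insert_le_m1 card_insert_if finite_subset[OF T(1) assms(1)] le_SucI)
  ultimately show ?case using T(1) x(1) by (intro exI[of _ "insert x T"]) simp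
qed

text \<open>By \<open>1 - p \<le> exp (- p)\<close>, fewer than \<open>exp (L - p * n) < 1\<close>
  sets survive \<open>n\<close> greedy steps; a cardinality below 1 is 0.\<close>

lemma exists_hitting_set:
  fixes G :: "'a set" and F :: "'a set set" and p :: real
  assumes "finite G" "G \<noteq> {}" "finite F" "p \<le> 1"
    and "\<And>S. S \<in> F \<Longrightarrow> S \<subseteq> G"
    and "\<And>S. S \<in> F \<Longrightarrow> p * real (card G) \<le> real (card S)"
    and few: "real (card F) \<le> exp L" "L < p * real n"
  shows "\<exists>T\<subseteq>G. card T \<le> n \<and> (\<forall>S\<in>F. S \<inter> T \<noteq> {})"
proof -
  obtain T where T: "T \<subseteq> G" "card T \<le> n"
    "real (card {S \<in> F. S \<inter> T = {}}) \<le> (1 - p) ^ n * real (card F)"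
    using greedy_hitting_set[of G F p n] assms by auto
  have "(1 - p) ^ n \<le> exp (- p) ^ n"
    using exp_ge_add_one_self[of "- p"] assms(4) by (intro power_mono) auto
  also have "\<dots> = exp (- (p * real n))" by (simp flip: exp_of_nat_mult add: mult_ac)
  finally have "(1 - p) ^ n * real (card F) \<le> exp (- (p * real n)) * exp L"
    using few(1) by (intro mult_mono) auto
  also have "\<dots> < 1" using few(2) by (simp flip: exp_add)
  finally have "card {S \<in> F. S \<inter> T = {}} = 0" using T(3) by simp
  then have "{S \<in> F. S \<inter> T = {}} = {}" using assms(3) by simp
  then show ?thesis using T by blast
qed

section \<open>Boxes\<close>

lemma interval_measurable_unit:
  fixes I :: "real set"
  assumes "is_interval I" "I \<subseteq> {0..1}"
  shows "I \<in> sets lborel" "emeasure lborel I = ennreal (measure lborel I)" "measure lborel I \<le> 1"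
proof -
  show meas: "I \<in> sets lborel" using real_interval_borel_measurable[OF assms(1)] by simp
  have le: "emeasure lborel I \<le> emeasure lborel {0..1::real}" using assms(2) by (intro emeasure_mono) auto
  then have "emeasure lborel I \<le> 1" by simp
  then have "emeasure lborel I \<noteq> \<infinity>" by (auto simp: top_unique)
  then show "emeasure lborel I = ennreal (measure lborel I)" by (simp add: emeasure_eq_ennreal_measure)
  with \<open>emeasure lborel I \<le> 1\<close> show "measure lborel I \<le> 1"
    by (simp add: ennreal_le_1)
qed

lemma lebesgue_volume_box:
  assumes "\<And>l. l < d \<Longrightarrow> is_interval (I l) \<and> I l \<subseteq> {0..1}"
  shows "lebesgue_volume d (\<Pi>\<^sub>E l\<in>{..<d}. I l) = (\<Prod>l<d. measure lborel (I l))"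
proof -
  interpret product_sigma_finite "\<lambda>_::nat. lborel :: real measure" ..
  have "emeasure (\<Pi>\<^sub>M l\<in>{..<d}. lborel) (\<Pi>\<^sub>E l\<in>{..<d}. I l) = (\<Prod>l<d. emeasure lborel (I l))"
    using assms interval_measurable_unit by (intro emeasure_PiM) auto
  also have "\<dots> = (\<Prod>l<d. ennreal (measure lborel (I l)))"
    using assms interval_measurable_unit by (intro prod.cong) auto
  also have "\<dots> = ennreal (\<Prod>l<d. measure lborel (I l))" by (simp add: prod_ennreal)
  finally show ?thesis
    unfolding lebesgue_volume_def measure_def[of "Pi\<^sub>M _ _"] by (simp add: prod_nonneg)
qed

lemma lebesgue_volume_box_le_1:
  assumes "B \<in> axis_parallel_boxes d"
  shows "lebesgue_volume d B \<le> 1"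
  using assms interval_measurable_unit(3)
  by (auto simp: axis_parallel_boxes_def lebesgue_volume_box intro!: prod_le_1)

text \<open>An empty factor is needed, hence \<open>d \<ge> 1\<close>: for \<open>d = 0\<close> the
  only box is a singleton. The empty box misses every point set and makes the suprema below range
  over nonempty sets.\<close>

lemma empty_in_axis_parallel_boxes:
  assumes "d \<ge> 1"
  shows "{} \<in> axis_parallel_boxes d"
proof -
  have "(\<Pi>\<^sub>E l\<in>{..<d}. {}::real set) = {}"
    using assms by (auto simp: PiE_eq_empty_iff intro!: exI[of _ 0])
  then show ?thesis
    unfolding axis_parallel_boxes_def mem_Collect_eq
    by (intro exI[of _ "\<lambda>_. {}"]) auto
qed

lemma dispersion_nonneg:
  assumes "d \<ge> 1"
  shows "0 \<le> dispersion d P"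
proof -
  have "lebesgue_volume d {} \<le> dispersion d P"
    unfolding dispersion_def using assms
    by (intro cSUP_upper bdd_aboveI2[of _ _ 1])
       (auto simp: empty_in_axis_parallel_boxes lebesgue_volume_box_le_1)
  then show ?thesis by (simp add: lebesgue_volume_def)
qed

lemma dispersion_leI:
  assumes "d \<ge> 1"
    and "\<And>B. B \<in> axis_parallel_boxes d \<Longrightarrow> \<epsilon> < lebesgue_volume d B \<Longrightarrow> B \<inter> P \<noteq> {}"
  shows "dispersion d P \<le> \<epsilon>"
  unfolding dispersion_def using assms empty_in_axis_parallel_boxes[of d]
  by (intro cSUP_least) (auto simp: not_less[symmetric])

text \<open>The diagonal embeds \<open>{0..1}\<close>. This supplies the points that pad a hitting
  set to a prescribed cardinality.\<close>

lemma infinite_unit_cube: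
  assumes "d \<ge> 1"
  shows "infinite (unit_cube d)"
proof
  assume fin: "finite (unit_cube d)"
  have "(\<lambda>t::real. \<lambda>l\<in>{..<d}. t) ` {0..1} \<subseteq> unit_cube d"
    unfolding unit_cube_def image_subset_iff restrict_PiE_iff by simp
  moreover have "inj_on (\<lambda>t::real. \<lambda>l\<in>{..<d}. t) {0..1}"
    using assms by (intro inj_onI) (auto dest!: fun_cong[of _ _ 0])
  ultimately have "finite {0..1::real}" using fin by (meson finite_subset finite_imageD)
  then show False by (simp add: infinite_Icc)
qed

text \<open>The minimal dispersion asks for exactly \<open>n\<close> points. Extra points of the
  cube can be added freely, since a box that meets \<open>T\<close> also meets every larger
  set.\<close>

lemma min_dispersion_le:
  assumes "d \<ge> 1" "T \<subseteq> unit_cube d" "finite T" "card T \<le> n"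
    and hit: "\<And>B. B \<in> axis_parallel_boxes d \<Longrightarrow> \<epsilon> < lebesgue_volume d B \<Longrightarrow> B \<inter> T \<noteq> {}"
  shows "min_dispersion n d \<le> \<epsilon>"
proof -
  have "infinite (unit_cube d - T)" using infinite_unit_cube assms by (simp add: Diff_infinite_finite)
  then obtain Q where Q: "finite Q" "card Q = n - card T" "Q \<subseteq> unit_cube d - T"
    using infinite_arbitrarily_large by blast
  have "card (T \<union> Q) = n" using Q assms by (subst card_Un_disjoint) auto
  then have "min_dispersion n d \<le> dispersion d (T \<union> Q)"
    unfolding min_dispersion_def using Q assms
    by (intro cINF_lower bdd_belowI2[of _ 0]) (auto simp: dispersion_nonneg)
  also have "\<dots> \<le> \<epsilon>" using assms(1) hit by (intro dispersion_leI) blast+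
  finally show ?thesis .
qed

section \<open>Traces of large boxes on the grid\<close>

text \<open>Up to its endpoints \<open>I\<close> is the open interval from \<open>u = Inf I\<close>
  to \<open>v = Sup I\<close>, and an open interval of length \<open>m * (v - u)\<close> contains at
  least \<open>m * (v - u) - 1\<close> integers. If that length exceeds \<open>m - 1\<close> inside
  \<open>{0..m}\<close>, then \<open>m * u < 1\<close> and \<open>m * v > m - 1\<close>, so every
  interior grid coordinate is caught. An interval without grid coordinates gives an empty
  \<open>{a..b}\<close>, which is why \<open>a = m\<close> and \<open>b = 0\<close> are
  allowed.\<close>

lemma interval_trace:
  fixes I :: "real set" and m :: nat
  assumes I: "is_interval I" "I \<subseteq> {0..1}" and "m \<ge> 1" and pos: "0 < measure lborel I"
  shows "\<exists>a b. a \<in> {1..m} \<and> b < m \<and> (\<forall>j\<in>{a..b}. real j / real m \<in> I) \<and>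
    real m * measure lborel I - 1 \<le> real (card {a..b}) \<and>
    (1 - 1 / real m < measure lborel I \<longrightarrow> {a..b} = {1..<m})"
proof -
  define u v where "u = Inf I" and "v = Sup I"
  have "I \<noteq> {}" using pos by auto
  have bdd: "bdd_below I" "bdd_above I"
    using I(2) by (meson bdd_below_mono bdd_above_mono bdd_below_Icc bdd_above_Icc)+
  have sub: "I \<subseteq> {u..v}" unfolding u_def v_def using bdd by (auto intro: cInf_lower cSup_upper)
  have sup: "{u<..<v} \<subseteq> I"
  proof
    fix t assume "t \<in> {u<..<v}"
    then obtain x y where "x \<in> I" "x < t" "y \<in> I" "t < y"
      unfolding u_def v_def using bdd \<open>I \<noteq> {}\<close> by (auto simp: cInf_less_iff less_cSup_iff)
    then show "t \<in> I" using I(1) by (meson is_interval_1 less_imp_le)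
  qed
  have u0: "0 \<le> u" and v1: "v \<le> 1"
    unfolding u_def v_def using I(2) \<open>I \<noteq> {}\<close> by (auto intro!: cInf_greatest cSup_least)
  have "u \<le> v" using sub \<open>I \<noteq> {}\<close> by fastforce
  have "emeasure lborel I \<le> emeasure lborel {u..v}" using sub by (intro emeasure_mono) auto
  moreover have "emeasure lborel {u<..<v} \<le> emeasure lborel I"
    using sup interval_measurable_unit(1)[OF I] by (intro emeasure_mono) auto
  ultimately have r: "measure lborel I = v - u"
    using \<open>u \<le> v\<close> interval_measurable_unit(2)[OF I] by (simp add: antisym)
  \<comment> \<open>The least integer strictly above \<open>m * u\<close> and the greatest strictly
    below \<open>m * v\<close>; strictness avoids asking whether \<open>u\<close> and
    \<open>v\<close> belong to \<open>I\<close>.\<close>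
  define a b where "a = nat (\<lfloor>m * u\<rfloor> + 1)" and "b = nat (\<lceil>m * v\<rceil> - 1)"
  have m: "real m > 0" using assms(3) by simp
  have mu: "0 \<le> m * u" "m * u < m" using u0 v1 pos r m by auto
  have mv: "0 < m * v" "m * v \<le> m" using u0 v1 pos r m by (auto simp: zero_less_mult_iff)
  have a: "real a = of_int \<lfloor>m * u\<rfloor> + 1" unfolding a_def using mu by simp
  have "\<lceil>m * v\<rceil> \<ge> 1" using mv(1) by linarith
  then have b: "real b = of_int \<lceil>m * v\<rceil> - 1" unfolding b_def by simp
  have a_bounds: "m * u < a" "a \<le> m * u + 1" using a by linarith+
  have b_bounds: "b < m * v" "m * v - 1 \<le> b" using b by linarith+
  have "a \<ge> 1" unfolding a_def using mu by linarith
  moreover have "a \<le> m" unfolding a_def using mu(2) by linarith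
  moreover have "b < m" using b_bounds mv by linarith
  moreover have "\<forall>j\<in>{a..b}. real j / real m \<in> I"
  proof
    fix j assume "j \<in> {a..b}"
    then have "m * u < j" "j < m * v" using a_bounds b_bounds by (auto simp: Ball_def)
    then have "real j / real m \<in> {u<..<v}" using m by (simp add: field_simps)
    then show "real j / real m \<in> I" using sup by auto
  qed
  moreover have "real b - real a + 1 \<le> real (card {a..b})" by simp
  then have "real m * measure lborel I - 1 \<le> real (card {a..b})"
    unfolding r using a_bounds b_bounds by (simp add: algebra_simps)
  moreover have "{a..b} = {1..<m}" if "1 - 1 / real m < measure lborel I"
  proof -
    have "real m - 1 < m * v - m * u" using that m r by (simp add: field_simps)
    then have "a < 2" "m - 1 \<le> b" using a_bounds b_bounds mu mv assms(3) by linarith+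
    then show ?thesis using \<open>a \<ge> 1\<close> \<open>b < m\<close> by auto
  qed
  ultimately show ?thesis by auto
qed

text \<open>A short side is at most \<open>1 - 1 / m \<le> exp (- 1 / m)\<close> and all others are
  at most 1, so \<open>k\<close> short sides force \<open>\<epsilon> < exp (- k / m)\<close>. The
  bound does not depend on \<open>d\<close>.\<close>

lemma card_short_sides:
  fixes r :: "nat \<Rightarrow> real" and m :: nat
  assumes "m \<ge> 2" "0 < \<epsilon>" "\<epsilon> < (\<Prod>l<d. r l)" and r: "\<And>l. l < d \<Longrightarrow> 0 < r l \<and> r l \<le> 1"
  shows "real (card {l. l < d \<and> r l \<le> 1 - 1 / real m}) \<le> real m * ln (1 / \<epsilon>)"
proof -
  let ?N = "{l. l < d \<and> r l \<le> 1 - 1 / real m}"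
  have "\<epsilon> < (\<Prod>l<d. r l)" by fact
  also have "\<dots> \<le> (\<Prod>l<d. if l \<in> ?N then exp (- 1 / real m) else 1)"
  proof (intro prod_mono conjI)
    fix l assume "l \<in> {..<d}"
    then show "0 \<le> r l" using r[of l] by simp
    show "r l \<le> (if l \<in> ?N then exp (- 1 / real m) else 1)"
      using r[of l] \<open>l \<in> _\<close> exp_ge_add_one_self[of "- 1 / real m"] by auto
  qed
  also have "\<dots> = exp (- 1 / real m) ^ card ?N"
    by (simp add: prod.If_cases) (simp add: Collect_conj_eq lessThan_def)
  also have "\<dots> = exp (- real (card ?N) / real m)" by (simp flip: exp_of_nat_mult)
  finally have "ln \<epsilon> < - real (card ?N) / real m"
    using assms(2) by (metis exp_less_cancel_iff exp_ln)
  then show ?thesis using assms(1,2) by (simp add: field_simps ln_div)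
qed

text \<open>With \<open>M = m - 1\<close> grid coordinates per axis, a side of length
  \<open>r\<close> catches at least \<open>(M + 1) * r - 1 = r * (1 - x / M) * M\<close> of them,
  where \<open>x = 1 / r - 1\<close>. The product of the \<open>r\<close> exceeds
  \<open>\<epsilon>\<close>, and the product of the corrections \<open>1 - x / M\<close> is at least
  \<open>1 / 2\<close> in every dimension, because the \<open>x\<close> have a sum of at most
  \<open>M / 2\<close>.\<close>

lemma density_of_large_box:
  fixes r k :: "nat \<Rightarrow> real" and M \<epsilon> :: real
  assumes \<epsilon>: "0 < \<epsilon>" "\<epsilon> < (\<Prod>l<d. r l)" and r: "\<And>l. l < d \<Longrightarrow> 0 < r l \<and> r l \<le> 1"
    and M: "2 / \<epsilon> \<le> M" and k: "\<And>l. l < d \<Longrightarrow> (M + 1) * r l - 1 \<le> k l"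
  shows "\<epsilon> / 2 * M ^ d \<le> (\<Prod>l<d. k l)"
proof -
  define x where "x l = 1 / r l - 1" for l
  have M0: "0 < M" using \<epsilon>(1) M by (smt (verit) divide_pos_pos)
  have x0: "0 \<le> x l" if "l < d" for l using r[OF that] by (simp add: x_def)
  \<comment> \<open>The choice of \<open>x\<close> makes \<open>1 + x l\<close> the reciprocal of
    \<open>r l\<close>, so the volume bound controls the sum of all rounding losses.\<close>
  have "(\<Sum>l<d. x l) \<le> (\<Prod>l<d. 1 + x l)" using x0 by (intro sum_le_prod) auto
  also have "\<dots> = 1 / (\<Prod>l<d. r l)" by (simp add: x_def prod_dividef)
  also have "\<dots> \<le> 1 / \<epsilon>" using \<epsilon> by (intro divide_left_mono) auto
  also have "\<dots> \<le> M / 2" using M by simp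
  finally have sumx: "(\<Sum>l<d. x l) \<le> M / 2" .
  \<comment> \<open>Keeps each \<open>x l / M\<close> in the unit interval for the Weierstrass
    inequality, and below keeps the factors \<open>(M + 1) * r l - 1\<close> nonnegative, so that
    the product is monotone.\<close>
  have xM: "x l \<le> M / 2" if "l < d" for l
    using member_le_sum[of l "{..<d}" x] x0 that sumx by auto
  have "1 / 2 \<le> 1 - (\<Sum>l<d. x l / M)"
    using sumx M0 by (simp add: field_simps flip: sum_divide_distrib)
  also have "\<dots> \<le> (\<Prod>l<d. 1 - x l / M)"
    using x0 xM M0 by (intro Weierstrass_prod_ineq) (force simp: field_simps)
  finally have half: "1 / 2 \<le> (\<Prod>l<d. 1 - x l / M)" .
  have "\<epsilon> / 2 * M ^ d = \<epsilon> * (1 / 2) * M ^ d" by simp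
  also have "\<dots> \<le> (\<Prod>l<d. r l) * (\<Prod>l<d. 1 - x l / M) * M ^ d"
    using \<epsilon> half M0 by (intro mult_right_mono mult_mono) auto
  also have "\<dots> = (\<Prod>l<d. r l * (1 - x l / M) * M)" by (simp add: prod.distrib)
  also have "\<dots> = (\<Prod>l<d. (M + 1) * r l - 1)"
  proof (intro prod.cong refl)
    fix l assume "l \<in> {..<d}"
    then have "r l \<noteq> 0" using r[of l] by auto
    then show "r l * (1 - x l / M) * M = (M + 1) * r l - 1" using M0 by (simp add: x_def field_simps)
  qed
  also have "\<dots> \<le> (\<Prod>l<d. k l)"
  proof (intro prod_mono conjI)
    fix l assume l: "l \<in> {..<d}"
    then show "(M + 1) * r l - 1 \<le> k l" using k by simp
    have "0 \<le> r l * (M - x l)" using r[of l] l xM[of l] M0 by (intro mult_nonneg_nonneg) auto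
    then show "0 \<le> (M + 1) * r l - 1" using r[of l] l by (simp add: x_def field_simps)
  qed
  finally show ?thesis .
qed

text \<open>
  Listing a full interval changes nothing, so every trace has codes of any prescribed length that is
  large enough. Codes of one fixed length are easy to count.
\<close>

definition grid :: "nat \<Rightarrow> nat \<Rightarrow> (nat \<Rightarrow> nat) set" where
  "grid d m = (\<Pi>\<^sub>E l\<in>{..<d}. {1..<m})"

definition coded_trace :: "nat \<Rightarrow> nat \<Rightarrow> (nat \<times> nat \<times> nat) list \<Rightarrow> (nat \<Rightarrow> nat) set" where
  "coded_trace d m xs = {x \<in> grid d m. \<forall>(l, a, b)\<in>set xs. x l \<in> {a..b}}"

definition grid_point :: "nat \<Rightarrow> nat \<Rightarrow> (nat \<Rightarrow> nat) \<Rightarrow> nat \<Rightarrow> real" where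
  "grid_point d m x = (\<lambda>l\<in>{..<d}. real (x l) / real m)"

lemma finite_grid: "finite (grid d m)"
  by (auto simp: grid_def intro: finite_PiE)

lemma card_grid: "card (grid d m) = (m - 1) ^ d"
  by (simp add: grid_def card_PiE)

lemma grid_point_in_unit_cube:
  "x \<in> grid d m \<Longrightarrow> grid_point d m x \<in> unit_cube d"
  by (fastforce simp: grid_def grid_point_def unit_cube_def restrict_PiE_iff divide_le_eq_1 dest: PiE_mem)

text \<open>Only coordinates whose interval is not full impose a constraint on grid points, so the
  length of a code is governed by their number and not by \<open>d\<close>.\<close>

lemma PiE_coded_trace:
  fixes a b :: "nat \<Rightarrow> nat"
  assumes ab: "\<And>l. l < d \<Longrightarrow> a l \<in> {1..m} \<and> b l < m" and "d \<ge> 1" "m \<ge> 1"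
    and N: "card {l. l < d \<and> {a l..b l} \<noteq> {1..<m}} \<le> A"
  shows "\<exists>xs. set xs \<subseteq> {..<d} \<times> {1..m} \<times> {..<m} \<and> length xs = A \<and>
    coded_trace d m xs = (\<Pi>\<^sub>E l\<in>{..<d}. {a l..b l})"
proof -
  let ?N = "{l. l < d \<and> {a l..b l} \<noteq> {1..<m}}"
  \<comment> \<open>The padding entry \<open>(0, 1, m - 1)\<close> is satisfied by every grid point;
    coordinate 0 exists because \<open>d \<ge> 1\<close>.\<close>
  define xs where "xs = map (\<lambda>l. (l, a l, b l)) (sorted_list_of_set ?N)
    @ replicate (A - card ?N) (0, 1, m - 1)"
  have set: "set xs \<subseteq> (\<lambda>l. (l, a l, b l)) ` ?N \<union> {(0, 1, m - 1)}" "(\<lambda>l. (l, a l, b l)) ` ?N \<subseteq> set xs"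
    unfolding xs_def by auto
  have "length xs = A" using N by (simp add: xs_def)
  moreover have "set xs \<subseteq> {..<d} \<times> {1..m} \<times> {..<m}"
    using set(1) ab assms(2,3) by fastforce
  moreover have "coded_trace d m xs = (\<Pi>\<^sub>E l\<in>{..<d}. {a l..b l})"
  proof (intro equalityI subsetI)
    fix x assume x: "x \<in> coded_trace d m xs"
    have "x l \<in> {a l..b l}" if "l < d" for l
    proof (cases "l \<in> ?N")
      case True
      then have "(l, a l, b l) \<in> set xs" using set(2) by blast
      then show ?thesis using x by (auto simp: coded_trace_def)
    next
      case False
      then have "{a l..b l} = {1..<m}" using that by simp
      then show ?thesis using x that by (auto simp: coded_trace_def grid_def PiE_iff)
    qed
    then show "x \<in> (\<Pi>\<^sub>E l\<in>{..<d}. {a l..b l})"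
      using x by (auto simp: coded_trace_def grid_def PiE_iff)
  next
    fix x assume x: "x \<in> (\<Pi>\<^sub>E l\<in>{..<d}. {a l..b l})"
    have range: "1 \<le> x l \<and> x l < m" if "l < d" for l
    proof -
      have "a l \<le> x l" "x l \<le> b l" using x that by (auto simp: PiE_iff)
      then show ?thesis using ab[OF that] by auto
    qed
    then have "x \<in> grid d m" using x by (auto simp: grid_def PiE_iff)
    moreover have "y \<in> set xs \<Longrightarrow> (case y of (l, a, b) \<Rightarrow> x l \<in> {a..b})" for y
      using set(1) x range[of 0] assms(2) by (auto simp: PiE_iff)
    ultimately show "x \<in> coded_trace d m xs" by (auto simp: coded_trace_def)
  qed
  ultimately show ?thesis by blast
qed

text \<open>Passes from boxes to finitely many traces: the length \<open>A\<close> depends only on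
  \<open>m\<close> and \<open>\<epsilon>\<close>, and since the trace lies in \<open>B\<close> after
  scaling, any point set hitting the trace hits the box.\<close>

lemma large_box_trace:
  assumes B: "B \<in> axis_parallel_boxes d" and vol: "\<epsilon> < lebesgue_volume d B"
    and "0 < \<epsilon>" "d \<ge> 1" "m \<ge> 2" and m: "2 / \<epsilon> \<le> real m - 1"
    and A: "A = nat \<lfloor>real m * ln (1 / \<epsilon>)\<rfloor>"
  shows "\<exists>xs. set xs \<subseteq> {..<d} \<times> {1..m} \<times> {..<m} \<and> length xs = A \<and>
    \<epsilon> / 2 * real (card (grid d m)) \<le> real (card (coded_trace d m xs)) \<and>
    grid_point d m ` coded_trace d m xs \<subseteq> B"
proof -
  obtain I where BI: "B = (\<Pi>\<^sub>E l\<in>{..<d}. I l)"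
    and I: "\<And>l. l < d \<Longrightarrow> is_interval (I l) \<and> I l \<subseteq> {0..1}"
    using B by (auto simp: axis_parallel_boxes_def)
  define r where "r l = measure lborel (I l)" for l
  have vol_r: "\<epsilon> < (\<Prod>l<d. r l)" using vol lebesgue_volume_box[OF I] BI by (simp add: r_def)
  \<comment> \<open>A side of measure 0 would make the volume vanish, so all sides have positive
    length.\<close>
  have "(\<Prod>l<d. r l) \<noteq> 0" using vol_r assms(3) by linarith
  then have r: "0 < r l \<and> r l \<le> 1" if "l < d" for l
    using that I[OF that] interval_measurable_unit(3)[of "I l"]
    by (auto simp: r_def zero_less_measure_iff)
  have "\<exists>a b. a \<in> {1..m} \<and> b < m \<and> (\<forall>j\<in>{a..b}. real j / real m \<in> I l) \<and>
    real m * r l - 1 \<le> real (card {a..b}) \<and> (1 - 1 / real m < r l \<longrightarrow> {a..b} = {1..<m})"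
    if "l < d" for l
    unfolding r_def using that I[OF that] r[OF that] assms(5) by (intro interval_trace) (auto simp: r_def)
  then obtain a b where ab: "\<And>l. l < d \<Longrightarrow> a l \<in> {1..m} \<and> b l < m"
    and in_I: "\<And>l j. l < d \<Longrightarrow> j \<in> {a l..b l} \<Longrightarrow> real j / real m \<in> I l"
    and many: "\<And>l. l < d \<Longrightarrow> real m * r l - 1 \<le> real (card {a l..b l})"
    and full: "\<And>l. l < d \<Longrightarrow> 1 - 1 / real m < r l \<Longrightarrow> {a l..b l} = {1..<m}"
    by metis
  \<comment> \<open>By contraposition of \<open>full\<close>, a coordinate that must be listed
    belongs to a short side.\<close>
  have "card {l. l < d \<and> {a l..b l} \<noteq> {1..<m}} \<le> card {l. l < d \<and> r l \<le> 1 - 1 / real m}"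
    using full by (intro card_mono) (auto simp: not_less[symmetric])
  moreover have "real (card {l. l < d \<and> r l \<le> 1 - 1 / real m}) \<le> real m * ln (1 / \<epsilon>)"
    using assms(3,5) vol_r r by (intro card_short_sides) auto
  ultimately have "card {l. l < d \<and> {a l..b l} \<noteq> {1..<m}} \<le> A"
    unfolding A by (simp add: le_nat_floor)
  then obtain xs where xs: "set xs \<subseteq> {..<d} \<times> {1..m} \<times> {..<m}" "length xs = A"
    "coded_trace d m xs = (\<Pi>\<^sub>E l\<in>{..<d}. {a l..b l})"
    using PiE_coded_trace[of d a m b A] ab assms(4,5) by auto
  have "\<epsilon> / 2 * (real m - 1) ^ d \<le> (\<Prod>l<d. real (card {a l..b l}))"
    using assms(3) vol_r r m many by (intro density_of_large_box[where r = r]) auto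
  also have "\<dots> = real (card (coded_trace d m xs))" by (simp add: xs(3) card_PiE)
  finally have "\<epsilon> / 2 * real (card (grid d m)) \<le> real (card (coded_trace d m xs))"
    using assms(5) by (simp add: card_grid of_nat_diff)
  moreover have "grid_point d m ` coded_trace d m xs \<subseteq> B"
    unfolding xs(3) BI using in_I by (auto simp: grid_point_def PiE_iff)
  ultimately show ?thesis using xs by blast
qed

section \<open>The upper bound\<close>

text \<open>Hits all dense traces with density \<open>p = \<epsilon> / 2\<close>. A code entry has
  \<open>d * m ^ 2\<close> possible values, so at most \<open>(d * m ^ 2) ^ A\<close> traces
  compete, with \<open>A \<le> m * ln (1 / \<epsilon>)\<close>.\<close>

lemma min_dispersion_le_of_many_points:
  fixes \<epsilon> :: real
  assumes \<epsilon>: "0 < \<epsilon>" "\<epsilon> < 1" and "d \<ge> 1" and m: "2 / \<epsilon> \<le> real m - 1"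
    and n: "2 / \<epsilon> * (real m * ln (1 / \<epsilon>) * ln (real d * real m ^ 2)) < real n"
  shows "min_dispersion n d \<le> \<epsilon>"
proof -
  have "2 / \<epsilon> > 0" using \<epsilon> by simp
  then have "m \<ge> 2" using m by linarith
  define A where "A = nat \<lfloor>real m * ln (1 / \<epsilon>)\<rfloor>"
  define X where "X = {..<d} \<times> {1..m} \<times> {..<m}"
  define C where "C = {xs. set xs \<subseteq> X \<and> length xs = A}"
  \<comment> \<open>Arbitrary codes may describe small or empty traces; keeping only the dense ones
    gives the density hypothesis of the hitting lemma, and large boxes still have a trace in
    \<open>F\<close>.\<close>
  define F where "F = {S \<in> coded_trace d m ` C. \<epsilon> / 2 * real (card (grid d m)) \<le> real (card S)}"
  have "finite X" "card X = d * m ^ 2" by (simp_all add: X_def card_cartesian_product power2_eq_square)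
  then have C: "finite C" "card C = (d * m ^ 2) ^ A"
    unfolding C_def by (simp_all add: finite_lists_length_eq card_lists_length_eq)
  have "finite F" unfolding F_def using C by simp
  have "card F \<le> card (coded_trace d m ` C)" unfolding F_def using C by (intro card_mono) auto
  also have "\<dots> \<le> (d * m ^ 2) ^ A" using C card_image_le by metis
  finally have "real (card F) \<le> (real d * real m ^ 2) ^ A"
    by (metis of_nat_le_iff of_nat_mult of_nat_power)
  also have "\<dots> = exp (real A * ln (real d * real m ^ 2))"
    using \<open>m \<ge> 2\<close> assms(3) by (simp add: exp_of_nat_mult)
  finally have card_F: "real (card F) \<le> exp (real A * ln (real d * real m ^ 2))" .
  \<comment> \<open>Makes the logarithm nonnegative, so that \<open>A\<close> may be replaced by its
    upper bound.\<close>
  have "1 \<le> real d * real m ^ 2" using \<open>m \<ge> 2\<close> assms(3) by (simp add: mult_ge1_I one_le_power)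
  moreover have "real A \<le> real m * ln (1 / \<epsilon>)" unfolding A_def using \<epsilon> by (intro of_nat_floor) simp
  ultimately have "real A * ln (real d * real m ^ 2) \<le> real m * ln (1 / \<epsilon>) * ln (real d * real m ^ 2)"
    by (intro mult_right_mono) auto
  also have "\<dots> < \<epsilon> / 2 * real n" using n \<epsilon> by (simp add: field_simps)
  finally have small: "real A * ln (real d * real m ^ 2) < \<epsilon> / 2 * real n" .
  have "grid d m \<noteq> {}"
    using \<open>m \<ge> 2\<close> by (auto simp: grid_def PiE_eq_empty_iff)
  then obtain T where T: "T \<subseteq> grid d m" "card T \<le> n" "\<And>S. S \<in> F \<Longrightarrow> S \<inter> T \<noteq> {}"
    using exists_hitting_set[of "grid d m" F "\<epsilon> / 2" "real A * ln (real d * real m ^ 2)" n]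
      finite_grid \<open>finite F\<close> \<epsilon> card_F small
    by (auto simp: F_def coded_trace_def)
  have "finite T" using T(1) finite_grid finite_subset by blast
  show ?thesis
  proof (rule min_dispersion_le[OF assms(3)])
    show "grid_point d m ` T \<subseteq> unit_cube d" using T(1) grid_point_in_unit_cube by blast
    show "finite (grid_point d m ` T)" using \<open>finite T\<close> by simp
    show "card (grid_point d m ` T) \<le> n" using card_image_le[OF \<open>finite T\<close>] T(2) by (rule order_trans)
  next
    fix B assume "B \<in> axis_parallel_boxes d" "\<epsilon> < lebesgue_volume d B"
    then obtain xs where "xs \<in> C" "\<epsilon> / 2 * real (card (grid d m)) \<le> real (card (coded_trace d m xs))"
      and sub: "grid_point d m ` coded_trace d m xs \<subseteq> B"
      using large_box_trace[of B d \<epsilon> m A] \<epsilon> assms(3) \<open>m \<ge> 2\<close> m A_def unfolding C_def X_def by auto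
    then have "coded_trace d m xs \<in> F" unfolding F_def by simp
    then show "B \<inter> grid_point d m ` T \<noteq> {}" using T(3) sub by blast
  qed
qed

lemma ln_le_log2: "1 \<le> x \<Longrightarrow> ln x \<le> log 2 x"
  using ln_2_less_1 by (simp add: log_def field_simps mult_right_le_one_le)

theorem corollary2:
  shows "\<exists>c::real. c > 0 \<and>
    (\<forall>(n::nat) (d::nat). n \<ge> 2 \<longrightarrow> d \<ge> 2 \<longrightarrow>
       min_dispersion n d \<le> c * log 2 (real n) * sqrt (log 2 (real d) / real n))"
\<comment> \<open>The square of the constant has to beat the factor \<open>24 = 2 * 4 * 3\<close>
  collected in the final estimate; \<open>10 ^ 2 = 100\<close> does.\<close>
proof (intro exI[of _ 10] conjI allI impI)
  fix n d :: nat
  assume n: "n \<ge> 2" and d: "d \<ge> 2"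
  define \<epsilon> where "\<epsilon> = 10 * log 2 (real n) * sqrt (log 2 (real d) / real n)"
  have logn: "1 \<le> log 2 (real n)" and logd: "1 \<le> log 2 (real d)" using n d by (simp_all add: le_log_iff)
  have \<epsilon>0: "0 < \<epsilon>" unfolding \<epsilon>_def using logn logd n by simp
  have \<epsilon>2: "\<epsilon> ^ 2 * real n = 100 * log 2 (real n) ^ 2 * log 2 (real d)"
    unfolding \<epsilon>_def using logd n by (simp add: power_mult_distrib)
  have "min_dispersion n d \<le> \<epsilon>"
  proof (cases "\<epsilon> < 1")
    \<comment> \<open>No box has volume above 1, so the empty set already hits all boxes of volume
      above \<open>\<epsilon>\<close>.\<close>
    case False
    have "card {} \<le> n" by simp
    then show ?thesis using False d lebesgue_volume_box_le_1
      by (intro min_dispersion_le[of d "{}"]) fastforce+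
  next
    case True
    \<comment> \<open>The least \<open>m\<close> with \<open>2 / \<epsilon> \<le> m - 1\<close>; as
      \<open>\<epsilon> < 1\<close>, it is still at most \<open>4 / \<epsilon>\<close>.\<close>
    define m where "m = nat \<lceil>2 / \<epsilon>\<rceil> + 1"
    have "real (nat \<lceil>2 / \<epsilon>\<rceil>) = of_int \<lceil>2 / \<epsilon>\<rceil>" using \<epsilon>0 by (simp add: of_nat_nat)
    then have m: "2 / \<epsilon> \<le> real m - 1" "real m < 2 / \<epsilon> + 2" unfolding m_def by linarith+
    then have m4: "real m \<le> 4 / \<epsilon>" using True \<epsilon>0 by (simp add: field_simps)
    have m1: "1 \<le> real m" by (simp add: m_def)
    have "1 \<le> log 2 (real n) ^ 2 * log 2 (real d)"
      using logn logd by (simp add: mult_ge1_I one_le_power)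
    \<comment> \<open>The definition of \<open>\<epsilon>\<close> forces \<open>n\<close> to be
      large, so \<open>1 / \<epsilon>\<close> and \<open>m\<close> are at most \<open>n\<close> and
      both logarithms are bounded by \<open>log 2 n\<close>.\<close>
    then have "(10 / \<epsilon>) ^ 2 \<le> real n" using \<epsilon>2 \<epsilon>0 by (simp add: field_simps)
    moreover have "10 / \<epsilon> \<le> (10 / \<epsilon>) ^ 2" using True \<epsilon>0 by (simp add: field_simps power2_eq_square)
    ultimately have n10: "10 / \<epsilon> \<le> real n" by linarith
    then have "1 / \<epsilon> \<le> real n" "real m \<le> real n"
      using m4 \<epsilon>0 divide_right_mono[of 1 10 \<epsilon>] divide_right_mono[of 4 10 \<epsilon>] by linarith+
    then have "ln (1 / \<epsilon>) \<le> ln (real n)" "ln (real m) \<le> ln (real n)" using \<epsilon>0 m1 n by (simp_all add: ln_mono)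
    then have ln\<epsilon>: "ln (1 / \<epsilon>) \<le> log 2 (real n)" and lnm: "ln (real m) \<le> log 2 (real n)"
      using ln_le_log2[of "real n"] n by linarith+
    have "ln (real d * real m ^ 2) = ln (real d) + 2 * ln (real m)"
      using d m1 by (simp add: ln_mult ln_realpow)
    also have "\<dots> \<le> log 2 (real d) + 2 * log 2 (real n)" using lnm ln_le_log2[of "real d"] d by simp
    \<comment> \<open>Both binary logarithms are at least 1, since \<open>n\<close> and
      \<open>d\<close> are at least 2, so a sum of them is absorbed into their product.\<close>
    also have "\<dots> \<le> log 2 (real n) * log 2 (real d) + 2 * (log 2 (real n) * log 2 (real d))"
      using logn logd by (intro add_mono mult_left_mono) (simp_all add: mult_le_cancel_left1 mult_le_cancel_right1)
    finally have lndm: "ln (real d * real m ^ 2) \<le> 3 * log 2 (real n) * log 2 (real d)" by (simp add: mult_ac)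
    have "1 \<le> real d * real m ^ 2" using m1 d by (simp add: mult_ge1_I one_le_power)
    then have "real m * ln (1 / \<epsilon>) * ln (real d * real m ^ 2)
        \<le> 4 / \<epsilon> * log 2 (real n) * (3 * log 2 (real n) * log 2 (real d))"
      using m4 ln\<epsilon> lndm \<epsilon>0 True logn by (intro mult_mono) (auto simp: ln_div)
    then have "2 / \<epsilon> * (real m * ln (1 / \<epsilon>) * ln (real d * real m ^ 2))
        \<le> 2 / \<epsilon> * (4 / \<epsilon> * log 2 (real n) * (3 * log 2 (real n) * log 2 (real d)))"
      using \<epsilon>0 by (intro mult_left_mono) auto
    also have "\<dots> = 24 * (log 2 (real n) ^ 2 * log 2 (real d)) / \<epsilon> ^ 2" by (simp add: power2_eq_square)
    also have "\<dots> = 24 / 100 * real n" using \<epsilon>2 \<epsilon>0 by (simp add: field_simps)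
    also have "\<dots> < real n" using n by simp
    finally show ?thesis using \<epsilon>0 True d m by (intro min_dispersion_le_of_many_points) auto
  qed
  then show "min_dispersion n d \<le> 10 * log 2 (real n) * sqrt (log 2 (real d) / real n)"
    by (simp add: \<epsilon>_def)
qed simp

end
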